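(* Let $G$ be a connected graph. Then there is a homeomorphism $\Theta_E(G)\cong\mathcal D_E(G)$ between the edge-tangle space of $G$ and the edge-direction space of $G$.
   Context: Graphs are simple and undirected, possibly infinite. For a finite set $F\subset E(G)$ of edges, let $\mathcal S^E_F$ be the set of infinite connected components of $G\setminus F$ (the graph obtained by deleting the edges in $F$). For finite $F\subset F'\subset E(G)$, each member of $\mathcal S^E_{F'}$ is contained in a unique member of $\mathcal S^E_F$; this defines a map $\varepsilon_{F,F'}:\mathcal S^E_{F'}\to\mathcal S^E_F$. Edge-directions: $\mathcal D_E(G)$ is the inverse limit $\varprojlim_F\mathcal S^E_F$ over finite $F\subset E(G)$ ordered by inclusion, each $\mathcal S^E_F$ discrete, with transition maps $\varepsilon_{F,F'}$, taken with the subspace topology of the product. Equivalently, its elements are functions $\rho$ choosing $\rho(F)\in\mathcal S^E_F$ with $\rho(F')\subset\rho(F)$ whenever $F\subset F'$. Edge-tangles: $\Theta_E(G)$ is the inverse limit, over finite $F\subset E(G)$ ordered by inclusion, of the spaces $\mathrm{Ult}(2^{\mathcal S^E_F})$ of ultrafilters on the set $\mathcal S^E_F$ with the Stone topology (basic open sets $\{u : \mathcal A\in u\}$, $\mathcal A\subset\mathcal S^E_F$), with transition maps sending $u\in\mathrm{Ult}(2^{\mathcal S^E_{F'}})$ to its pushforward $\{\mathcal A\subset\mathcal S^E_F : \varepsilon_{F,F'}^{-1}(\mathcal A)\in u\}$. If $\mathcal S^E_F=\emptyset$ there are no ultrafilters on it. *)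

theory Defs
  imports "HOL-Analysis.Analysis" "HOL-Library.Ramsey"
begin

subsection \<open>Graphs and their infinite components\<close>

text \<open>A graph is given by its vertex set \<open>V\<close> (of arbitrary cardinality) and its edge set \<open>E\<close>,
  a set of 2-element subsets of \<open>V\<close>.\<close>

definition simple_graph :: "'a set \<Rightarrow> 'a set set \<Rightarrow> bool" where
  "simple_graph V E \<longleftrightarrow> E \<subseteq> [V]\<^bsup>2\<^esup>"

definition adjacency :: "'a set set \<Rightarrow> ('a \<times> 'a) set" where
  "adjacency E = {(u, v). {u, v} \<in> E}"

text \<open>Not requiring \<open>V\<close> to be nonempty counts the empty graph as connected.\<close>

definition connected_graph :: "'a set \<Rightarrow> 'a set set \<Rightarrow> bool" where
  "connected_graph V E \<longleftrightarrow> (\<forall>u\<in>V. \<forall>v\<in>V. (u, v) \<in> (adjacency E)\<^sup>*)"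

text \<open>Components are represented by their vertex sets. The component itself is the subgraph
  induced on this set, so it is infinite iff the set is, and inclusion of components
  is inclusion of vertex sets.\<close>

definition graph_components :: "'a set \<Rightarrow> 'a set set \<Rightarrow> 'a set set" where
  "graph_components V E = V // {(u, v) \<in> V \<times> V. (u, v) \<in> (adjacency E)\<^sup>*}"

definition infinite_components :: "'a set \<Rightarrow> 'a set set \<Rightarrow> 'a set set \<Rightarrow> 'a set set" where
  "infinite_components V E F = {C \<in> graph_components V (E - F). infinite C}"

text \<open>The map \<open>\<epsilon>\<^bsub>F,F'\<^esub>\<close> does not mention \<open>F'\<close>, which only
  determines the domain. That it is well defined is proved below.\<close>

definition comp_map :: "'a set \<Rightarrow> 'a set set \<Rightarrow> 'a set set \<Rightarrow> 'a set \<Rightarrow> 'a set" where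
  "comp_map V E F C' = (THE C. C \<in> infinite_components V E F \<and> C' \<subseteq> C)"

lemma infinite_components_ex1_superset:
  assumes "F \<subseteq> F'" "C' \<in> infinite_components V E F'"
  shows "\<exists>!C. C \<in> infinite_components V E F \<and> C' \<subseteq> C"
proof -
  define R where "R = (\<lambda>H. {(u, v) \<in> V \<times> V. (u, v) \<in> (adjacency (E - H))\<^sup>*})"
  have components: "graph_components V (E - H) = V // R H" for H
    by (simp add: graph_components_def R_def)
  have equiv: "equiv V (R H)" for H
  proof (rule equivI)
    show "R H \<subseteq> V \<times> V" by (auto simp: R_def)
    show "refl_on V (R H)" by (auto simp: R_def refl_on_def)
    have "sym ((adjacency (E - H))\<^sup>*)"
      by (rule sym_rtrancl) (auto simp: sym_def adjacency_def insert_commute)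
    then show "sym (R H)" by (auto simp: R_def sym_def)
    show "trans (R H)" by (auto simp: R_def trans_def)
  qed
  have mono: "R F' \<subseteq> R F"
    using rtrancl_mono[of "adjacency (E - F')" "adjacency (E - F)"] assms(1)
    by (auto simp: R_def adjacency_def)
  from assms(2) obtain v where v: "v \<in> V" "C' = R F' `` {v}" "infinite C'"
    by (auto simp: infinite_components_def components elim!: quotientE)
  have vC': "v \<in> C'" using v(1,2) by (auto simp: R_def)
  have sub: "C' \<subseteq> R F `` {v}" using v mono by auto
  have inf: "infinite (R F `` {v})" using v(3) sub finite_subset by blast
  show ?thesis
  proof
    show "R F `` {v} \<in> infinite_components V E F \<and> C' \<subseteq> R F `` {v}"
      using sub inf quotientI[OF v(1), of "R F"]
      by (simp add: infinite_components_def components)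
  next
    fix C assume C: "C \<in> infinite_components V E F \<and> C' \<subseteq> C"
    then have "C \<in> V // R F" "v \<in> C"
      using vC' by (auto simp: infinite_components_def components)
    then obtain w where w: "C = R F `` {w}" by (auto elim: quotientE)
    with \<open>v \<in> C\<close> have "(w, v) \<in> R F" by simp
    with w show "C = R F `` {v}"
      using equiv_class_eq[OF equiv] by simp
  qed
qed

subsection \<open>Inverse limits and spaces of ultrafilters\<close>

text \<open>\<open>X\<close> is an inverse system over the poset \<open>I\<close> with transition maps
  \<open>f i j\<close> from \<open>X j\<close> to \<open>X i\<close> for \<open>i \<le> j\<close>.\<close>

definition inverse_limit ::
  "'i::order set \<Rightarrow> ('i \<Rightarrow> 'b topology) \<Rightarrow> ('i \<Rightarrow> 'i \<Rightarrow> 'b \<Rightarrow> 'b) \<Rightarrow> ('i \<Rightarrow> 'b) topology" where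
  "inverse_limit I X f =
     subtopology (product_topology X I) {x. \<forall>i\<in>I. \<forall>j\<in>I. i \<le> j \<longrightarrow> f i j (x j) = x i}"

definition ultrafilters_on :: "'b set \<Rightarrow> 'b set set set" where
  "ultrafilters_on S = {u. u \<subseteq> Pow S \<and> S \<in> u \<and> {} \<notin> u
     \<and> (\<forall>A\<in>u. \<forall>B\<in>u. A \<inter> B \<in> u)
     \<and> (\<forall>A\<in>u. \<forall>B. A \<subseteq> B \<and> B \<subseteq> S \<longrightarrow> B \<in> u)
     \<and> (\<forall>A. A \<subseteq> S \<longrightarrow> A \<in> u \<or> S - A \<in> u)}"

definition stone_topology :: "'b set \<Rightarrow> 'b set set topology" where
  "stone_topology S = topology_generated_by {{u \<in> ultrafilters_on S. A \<in> u} | A. A \<subseteq> S}"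

lemma topspace_stone_topology: "topspace (stone_topology S) = ultrafilters_on S"
  by (auto simp: stone_topology_def ultrafilters_on_def)

definition ultrafilter_push :: "'b set \<Rightarrow> 'c set \<Rightarrow> ('b \<Rightarrow> 'c) \<Rightarrow> 'b set set \<Rightarrow> 'c set set" where
  "ultrafilter_push S T f u = {A. A \<subseteq> T \<and> {x \<in> S. f x \<in> A} \<in> u}"

subsection \<open>Edge-directions and edge-tangles\<close>

definition finite_edge_sets :: "'a set set \<Rightarrow> 'a set set set" where
  "finite_edge_sets E = {F. finite F \<and> F \<subseteq> E}"

definition edge_direction_space :: "'a set \<Rightarrow> 'a set set \<Rightarrow> ('a set set \<Rightarrow> 'a set) topology" where
  "edge_direction_space V E =
     inverse_limit (finite_edge_sets E)
       (\<lambda>F. discrete_topology (infinite_components V E F))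
       (\<lambda>F F'. comp_map V E F)"

definition edge_tangle_space ::
  "'a set \<Rightarrow> 'a set set \<Rightarrow> ('a set set \<Rightarrow> 'a set set set) topology" where
  "edge_tangle_space V E =
     inverse_limit (finite_edge_sets E)
       (\<lambda>F. stone_topology (infinite_components V E F))
       (\<lambda>F F'. ultrafilter_push (infinite_components V E F') (infinite_components V E F)
                 (comp_map V E F))"

end

(* Deleting finitely many edges from a connected graph leaves only finitely many components, since
   every component meets the finite set consisting of a fixed root and the endpoints of the deleted
   edges. Hence all ultrafilters on the sets of infinite components are principal, so that sending a
   component to its principal ultrafilter is a homeomorphism at every finite edge set. These
   homeomorphisms commute with the transition maps and thus induce one of the inverse limits. *)

theory Submission
  imports Defs
begin

lemma topspace_inverse_limit:
  "topspace (inverse_limit I X f) =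
     {x \<in> \<Pi>\<^sub>E i\<in>I. topspace (X i). \<forall>i\<in>I. \<forall>j\<in>I. i \<le> j \<longrightarrow> f i j (x j) = x i}"
  by (auto simp: inverse_limit_def)

text \<open>Continuity into a product is checked one coordinate at a time, and compatibility puts
  the image inside the limit. The values are restricted to \<open>I\<close> because points of a
  product topology are extensional functions. Compatibility is demanded only along threads, where
  \<open>x i\<close> is already the image of \<open>x j\<close>.\<close>

lemma continuous_map_inverse_limit_levelwise:
  assumes "\<And>i. i \<in> I \<Longrightarrow> continuous_map (X i) (Y i) (p i)"
    and "\<And>x i j. x \<in> topspace (inverse_limit I X f) \<Longrightarrow> i \<in> I \<Longrightarrow> j \<in> I \<Longrightarrow> i \<le> j
           \<Longrightarrow> g i j (p j (x j)) = p i (x i)"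
  shows "continuous_map (inverse_limit I X f) (inverse_limit I Y g) (\<lambda>x. \<lambda>i\<in>I. p i (x i))"
proof -
  have "continuous_map (inverse_limit I X f) (product_topology Y I) (\<lambda>x. \<lambda>i\<in>I. p i (x i))"
    unfolding continuous_map_componentwise
  proof (intro conjI ballI)
    fix i assume i: "i \<in> I"
    have "continuous_map (inverse_limit I X f) (X i) (\<lambda>x. x i)"
      unfolding inverse_limit_def
      by (intro continuous_map_from_subtopology continuous_map_product_projection i)
    from continuous_map_compose[OF this assms(1)[OF i]]
    show "continuous_map (inverse_limit I X f) (Y i) (\<lambda>x. (\<lambda>i\<in>I. p i (x i)) i)"
      using i by (simp add: o_def)
  qed auto
  moreover have "(\<lambda>x. \<lambda>i\<in>I. p i (x i)) \<in> topspace (inverse_limit I X f)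
      \<rightarrow> {y. \<forall>i\<in>I. \<forall>j\<in>I. i \<le> j \<longrightarrow> g i j (y j) = y i}"
    using assms(2) by auto
  ultimately show ?thesis
    \<comment> \<open>Only the target limit is unfolded, so that continuity splits into continuity
      into the full product and membership in the set of threads.\<close>
    by (subst (2) inverse_limit_def) (simp add: continuous_map_in_subtopology image_subset_iff_funcset)
qed

text \<open>Commuting squares for the \<open>p i\<close> suffice, since the inverses inherit them.
  The levelwise inverses are chosen simultaneously and act coordinatewise.\<close>

lemma homeomorphic_space_inverse_limit:
  assumes hom: "\<And>i. i \<in> I \<Longrightarrow> homeomorphic_map (X i) (Y i) (p i)"
    and maps: "\<And>i j x. i \<in> I \<Longrightarrow> j \<in> I \<Longrightarrow> i \<le> j \<Longrightarrow> x \<in> topspace (X j) \<Longrightarrow> f i j x \<in> topspace (X i)"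
    and comm: "\<And>i j x. i \<in> I \<Longrightarrow> j \<in> I \<Longrightarrow> i \<le> j \<Longrightarrow> x \<in> topspace (X j)
                 \<Longrightarrow> g i j (p j x) = p i (f i j x)"
  shows "inverse_limit I X f homeomorphic_space inverse_limit I Y g"
proof -
  have "\<forall>i\<in>I. \<exists>q. homeomorphic_maps (X i) (Y i) (p i) q"
    using hom by (simp add: homeomorphic_map_maps)
  then obtain q where "\<forall>i\<in>I. homeomorphic_maps (X i) (Y i) (p i) (q i)"
    by (rule bchoice[THEN exE])
  then have p: "continuous_map (X i) (Y i) (p i)" and q: "continuous_map (Y i) (X i) (q i)"
    and qp: "x \<in> topspace (X i) \<Longrightarrow> q i (p i x) = x"
    and pq: "y \<in> topspace (Y i) \<Longrightarrow> p i (q i y) = y" if "i \<in> I" for i x y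
    using that by (auto simp: homeomorphic_maps_def)
  have q_in: "q i y \<in> topspace (X i)" if "i \<in> I" "y \<in> topspace (Y i)" for i y
    using continuous_map_funspace[OF q[OF that(1)]] that(2) by auto
  have "homeomorphic_maps (inverse_limit I X f) (inverse_limit I Y g)
          (\<lambda>x. \<lambda>i\<in>I. p i (x i)) (\<lambda>y. \<lambda>i\<in>I. q i (y i))"
    unfolding homeomorphic_maps_def
  proof (intro conjI ballI)
    show "continuous_map (inverse_limit I X f) (inverse_limit I Y g) (\<lambda>x. \<lambda>i\<in>I. p i (x i))"
      by (rule continuous_map_inverse_limit_levelwise)
        (auto simp: topspace_inverse_limit PiE_iff p comm)
    show "continuous_map (inverse_limit I Y g) (inverse_limit I X f) (\<lambda>y. \<lambda>i\<in>I. q i (y i))"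
    proof (rule continuous_map_inverse_limit_levelwise)
      fix y i j
      assume y: "y \<in> topspace (inverse_limit I Y g)" and ij: "i \<in> I" "j \<in> I" "i \<le> j"
      then have yj: "y j \<in> topspace (Y j)" and yi: "g i j (y j) = y i"
        by (auto simp: topspace_inverse_limit)
      \<comment> \<open>Inserting \<open>q i\<close> after \<open>p i\<close> turns the square for
        \<open>q\<close> into the one for \<open>p\<close>; by \<open>maps\<close> the point lies in
        \<open>X i\<close>, where the two cancel.\<close>
      have "f i j (q j (y j)) = q i (p i (f i j (q j (y j))))"
        using ij yj by (simp add: qp maps q_in)
      also have "\<dots> = q i (y i)"
        using ij yj yi by (simp add: comm[symmetric] q_in pq)
      finally show "f i j (q j (y j)) = q i (y i)" .
    qed (rule q)
  next
    fix x assume "x \<in> topspace (inverse_limit I X f)"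
    then show "(\<lambda>i\<in>I. q i ((\<lambda>i\<in>I. p i (x i)) i)) = x"
      by (auto simp: topspace_inverse_limit PiE_iff extensional_def fun_eq_iff qp)
  next
    fix y assume "y \<in> topspace (inverse_limit I Y g)"
    then show "(\<lambda>i\<in>I. p i ((\<lambda>i\<in>I. q i (y i)) i)) = y"
      by (auto simp: topspace_inverse_limit PiE_iff extensional_def fun_eq_iff pq)
  qed
  then show ?thesis by (rule homeomorphic_maps_imp_homeomorphic_space)
qed

definition principal_ultrafilter :: "'b set \<Rightarrow> 'b \<Rightarrow> 'b set set" where
  "principal_ultrafilter S x = {A. A \<subseteq> S \<and> x \<in> A}"

lemma principal_ultrafilter_in_ultrafilters_on:
  "x \<in> S \<Longrightarrow> principal_ultrafilter S x \<in> ultrafilters_on S"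
  by (auto simp: principal_ultrafilter_def ultrafilters_on_def)

text \<open>If no singleton belonged to \<open>u\<close>, all complements of singletons would.
  Intersecting these finitely many sets would put the empty set into \<open>u\<close>. A singleton
  \<open>{x}\<close> in \<open>u\<close> then forces \<open>x\<close> into every member, as members
  of \<open>u\<close> cannot be disjoint.\<close>

lemma ultrafilter_on_finite_principal:
  assumes "finite S" "u \<in> ultrafilters_on S"
  obtains x where "x \<in> S" "u = principal_ultrafilter S x"
proof -
  have u: "u \<subseteq> Pow S" "S \<in> u" "{} \<notin> u" "\<And>A B. A \<in> u \<Longrightarrow> B \<in> u \<Longrightarrow> A \<inter> B \<in> u"
    "\<And>A B. A \<in> u \<Longrightarrow> A \<subseteq> B \<Longrightarrow> B \<subseteq> S \<Longrightarrow> B \<in> u" "\<And>A. A \<subseteq> S \<Longrightarrow> A \<in> u \<or> S - A \<in> u"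
    using assms(2) unfolding ultrafilters_on_def by blast+
  have "\<exists>x\<in>S. {x} \<in> u"
  proof (rule ccontr)
    assume "\<not> (\<exists>x\<in>S. {x} \<in> u)"
    then have co: "S - {x} \<in> u" if "x \<in> S" for x
      using u(6)[of "{x}"] that by auto
    have "S - B \<in> u" if "finite B" "B \<subseteq> S" for B
      using that
    proof (induction B rule: finite_induct)
      case (insert x B)
      then have "(S - B) \<inter> (S - {x}) \<in> u" using co u(4) by simp
      moreover have "(S - B) \<inter> (S - {x}) = S - insert x B" by auto
      ultimately show ?case by simp
    qed (simp add: u(2))
    from this[of S] show False using assms(1) u(3) by simp
  qed
  then obtain x where x: "x \<in> S" "{x} \<in> u" by blast
  have "u = principal_ultrafilter S x"
  proof (intro set_eqI iffI)
    fix A assume A: "A \<in> u"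
    have "A \<inter> {x} \<noteq> {}" using u(3) u(4)[OF A x(2)] by metis
    then show "A \<in> principal_ultrafilter S x"
      using A u(1) by (auto simp: principal_ultrafilter_def)
  next
    fix A assume "A \<in> principal_ultrafilter S x"
    then show "A \<in> u" using u(5)[OF x(2)] by (simp add: principal_ultrafilter_def)
  qed
  with x(1) show thesis by (rule that)
qed

text \<open>The right-hand side is a basic open set of the Stone topology, so this yields openness
  of the principal embedding and, for \<open>U = S\<close>, its surjectivity.\<close>

lemma image_principal_ultrafilter:
  assumes "finite S" "U \<subseteq> S"
  shows "principal_ultrafilter S ` U = {u \<in> ultrafilters_on S. U \<in> u}"
proof (intro set_eqI iffI)
  fix u assume "u \<in> principal_ultrafilter S ` U"
  then obtain x where "x \<in> U" "u = principal_ultrafilter S x" by blast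
  then show "u \<in> {u \<in> ultrafilters_on S. U \<in> u}"
    using assms(2) principal_ultrafilter_in_ultrafilters_on[of x S]
    by (auto simp: principal_ultrafilter_def)
next
  fix u assume u: "u \<in> {u \<in> ultrafilters_on S. U \<in> u}"
  then obtain x where x: "u = principal_ultrafilter S x"
    using ultrafilter_on_finite_principal[OF assms(1)] by blast
  with u have "x \<in> U" by (simp add: principal_ultrafilter_def)
  with x show "u \<in> principal_ultrafilter S ` U" by blast
qed

lemma homeomorphic_map_principal_ultrafilter:
  assumes "finite S"
  shows "homeomorphic_map (discrete_topology S) (stone_topology S) (principal_ultrafilter S)"
proof (rule bijective_open_imp_homeomorphic_map)
  show "continuous_map (discrete_topology S) (stone_topology S) (principal_ultrafilter S)"
    by (auto simp: topspace_stone_topology principal_ultrafilter_in_ultrafilters_on)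
  show "open_map (discrete_topology S) (stone_topology S) (principal_ultrafilter S)"
    unfolding open_map_def
  proof (intro allI impI)
    fix U assume "openin (discrete_topology S) U"
    then have U: "U \<subseteq> S" by simp
    have "principal_ultrafilter S ` U = {u \<in> ultrafilters_on S. U \<in> u}"
      by (rule image_principal_ultrafilter[OF assms U])
    then show "openin (stone_topology S) (principal_ultrafilter S ` U)"
      unfolding stone_topology_def using U by (auto intro: topology_generated_by_Basis)
  qed
  show "principal_ultrafilter S ` topspace (discrete_topology S) = topspace (stone_topology S)"
    using image_principal_ultrafilter[OF assms order_refl]
    by (auto simp: topspace_stone_topology ultrafilters_on_def)
  show "inj_on (principal_ultrafilter S) (topspace (discrete_topology S))"
  proof (rule inj_onI)
    fix x y
    assume x: "x \<in> topspace (discrete_topology S)"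
      and eq: "principal_ultrafilter S x = principal_ultrafilter S y"
    \<comment> \<open>The singleton \<open>{x}\<close> separates the principal ultrafilter at
      \<open>x\<close> from that at any other point.\<close>
    from x have "{x} \<in> principal_ultrafilter S x" by (simp add: principal_ultrafilter_def)
    then have "{x} \<in> principal_ultrafilter S y" by (simp only: eq)
    then show "x = y" by (simp add: principal_ultrafilter_def)
  qed
qed

text \<open>This is the commuting square between the transition maps of directions and those of
  tangles.\<close>

lemma ultrafilter_push_principal:
  assumes "x \<in> S" "f x \<in> T"
  shows "ultrafilter_push S T f (principal_ultrafilter S x) = principal_ultrafilter T (f x)"
  using assms by (auto simp: ultrafilter_push_def principal_ultrafilter_def)

text \<open>Follow a walk from \<open>v\<close> to \<open>r\<close> until it is about to use a
  deleted edge: the vertex reached is an endpoint of that edge, and if this never happens the walk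
  reaches \<open>r\<close>. In the induction, a deleted first edge makes \<open>v\<close> itself the
  witness; otherwise the first edge is prepended.\<close>

lemma rtrancl_adjacency_meets_deleted_edges:
  assumes "(v, r) \<in> (adjacency E)\<^sup>*"
  shows "\<exists>w \<in> insert r (\<Union>F). (v, w) \<in> (adjacency (E - F))\<^sup>*"
  using assms
proof (induction rule: converse_rtrancl_induct)
  case (step v y)
  show ?case
  proof (cases "{v, y} \<in> F")
    case True
    then show ?thesis by blast
  next
    case False
    with step.hyps(1) have "(v, y) \<in> adjacency (E - F)" by (simp add: adjacency_def)
    with step.IH show ?thesis by (meson converse_rtrancl_into_rtrancl)
  qed
qed blast

lemma finite_graph_components_delete_edges:
  assumes "simple_graph V E" "connected_graph V E" "finite F" "F \<subseteq> E"
  shows "finite (graph_components V (E - F))"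
\<comment> \<open>The empty graph counts as connected but offers no root \<open>r\<close>.\<close>
proof (cases "V = {}")
  case True
  then show ?thesis by (simp add: graph_components_def)
next
  case False
  then obtain r where r: "r \<in> V" by blast
  define R where "R = {(u, v) \<in> V \<times> V. (u, v) \<in> (adjacency (E - F))\<^sup>*}"
  \<comment> \<open>Finiteness of edges bounds the set of representatives; containment in
    \<open>V\<close> makes each endpoint a legitimate representative, as \<open>R\<close> lives on
    \<open>V\<close>.\<close>
  have edge: "finite e" "e \<subseteq> V" if "e \<in> F" for e
    using that assms(1,4) by (auto simp: simple_graph_def nsets_def)
  have "sym ((adjacency (E - F))\<^sup>*)"
    by (rule sym_rtrancl) (auto simp: sym_def adjacency_def insert_commute)
  then have equiv: "equiv V R"
    by (auto simp: R_def equiv_def refl_on_def sym_def trans_def)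
  have "V // R \<subseteq> (\<lambda>w. R `` {w}) ` insert r (\<Union>F)"
  proof
    fix C assume "C \<in> V // R"
    then obtain v where v: "v \<in> V" "C = R `` {v}" by (auto elim: quotientE)
    with r assms(2) have "(v, r) \<in> (adjacency E)\<^sup>*" by (simp add: connected_graph_def)
    from rtrancl_adjacency_meets_deleted_edges[OF this, of F]
    obtain w where w: "w \<in> insert r (\<Union>F)" "(v, w) \<in> (adjacency (E - F))\<^sup>*" ..
    have "w \<in> V" using w(1) r edge(2) by auto
    with v w(2) have "(v, w) \<in> R" by (simp add: R_def)
    then have "C = R `` {w}" using v(2) equiv_class_eq[OF equiv] by simp
    with w(1) show "C \<in> (\<lambda>w. R `` {w}) ` insert r (\<Union>F)" by blast
  qed
  then have "finite (V // R)"
    by (rule finite_subset) (simp add: assms(3) edge(1))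
  then show ?thesis by (simp add: graph_components_def R_def)
qed

lemma comp_map_in_infinite_components:
  assumes "F \<subseteq> F'" "C' \<in> infinite_components V E F'"
  shows "comp_map V E F C' \<in> infinite_components V E F"
  using theI'[OF infinite_components_ex1_superset[OF assms]] by (simp add: comp_map_def)

theorem proposition9:
  fixes V :: "'a set" and E :: "'a set set"
  assumes "simple_graph V E" and "connected_graph V E"
  shows "edge_tangle_space V E homeomorphic_space edge_direction_space V E"
proof -
  \<comment> \<open>Simplicity and connectedness of the graph enter only through this
    finiteness.\<close>
  have fin: "finite (infinite_components V E F)" if "F \<in> finite_edge_sets E" for F
    using that finite_graph_components_delete_edges[OF assms, of F]
    by (simp add: finite_edge_sets_def infinite_components_def)
  \<comment> \<open>The explicit map runs from directions to tangles, so this orientation is proved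
    and then reversed by symmetry.\<close>
  have "edge_direction_space V E homeomorphic_space edge_tangle_space V E"
    unfolding edge_direction_space_def edge_tangle_space_def
  proof (rule homeomorphic_space_inverse_limit
      [where p = "\<lambda>F. principal_ultrafilter (infinite_components V E F)"])
    fix F F' C assume "F \<subseteq> F'" "C \<in> topspace (discrete_topology (infinite_components V E F'))"
    then have C: "C \<in> infinite_components V E F'" "comp_map V E F C \<in> infinite_components V E F"
      by (auto intro: comp_map_in_infinite_components)
    then show "comp_map V E F C \<in> topspace (discrete_topology (infinite_components V E F))"
      by simp
    from C show "ultrafilter_push (infinite_components V E F') (infinite_components V E F)
        (comp_map V E F) (principal_ultrafilter (infinite_components V E F') C) =
      principal_ultrafilter (infinite_components V E F) (comp_map V E F C)"
      by (rule ultrafilter_push_principal)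
  qed (rule homeomorphic_map_principal_ultrafilter[OF fin])
  then show ?thesis by (subst homeomorphic_space_sym)
qed

end
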